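(* Let $0<\mu<\beta<\infty$ and $\sigma\in(0,\sigma_{\max})$ with $\sigma_{\max}=\sqrt{\mu(\beta-\mu)}$. If $\sigma\le\min\{\delta^*,\sigma^*\}$, then $\pi_l^*<p_l^*$. If $\sigma\ge\max\{\delta^*,\sigma^*\}$, then $\pi_h^*>p_h^*$.
   Context: $\mathcal{P}(\mu,\sigma,\beta)$ is the set of all probability distributions $\mathbb{P}$ of a real random variable $X$ with $\mathbb{P}(X\in[0,\beta])=1$, $\mathbb{E}_{\mathbb{P}}(X)=\mu$ and $\mathbb{E}_{\mathbb{P}}(X^2)=\mu^2+\sigma^2$. For $p>0$, $\mathrm{REV}(p,\mathbb{P})=p\,\mathbb{P}(X\ge p)$ and $\mathrm{CR}(p,\mathbb{P})=\mathrm{REV}(p,\mathbb{P})/\sup_{t>0}\mathrm{REV}(t,\mathbb{P})$. Put $\tau_2=\mu+\sigma^2/\mu$ (so $\tau_2<\beta$). All cube roots are real. Competitive-ratio prices: $$p_l^*=\mu-\sigma\left(\left(\tfrac{\mu}{2\sigma}+\sqrt{\tfrac{8}{27}+\left(\tfrac{\mu}{2\sigma}\right)^2}\right)^{1/3}+\left(\tfrac{\mu}{2\sigma}-\sqrt{\tfrac{8}{27}+\left(\tfrac{\mu}{2\sigma}\right)^2}\right)^{1/3}\right),$$ $$p_h^*=\max\left\{\tfrac12\left(\beta+\tau_2-\sqrt{(3\beta-\tau_2)^2-4\beta^2}\right),\ \tfrac{\tau_2}{2}\right\}.$$ $\sigma^*\in(0,\sigma_{\max})$ is the threshold (depending on $\mu,\beta$)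 such that $\sup_{p>0}\inf_{\mathbb{P}\in\mathcal{P}(\mu,\sigma,\beta)}\mathrm{CR}(p,\mathbb{P})$ is attained at $p_l^*$ for $\sigma\le\sigma^*$ and at $p_h^*$ for $\sigma\ge\sigma^*$. Expected-revenue prices: $$\pi_l^*=\mu-\sigma\left(\left(\tfrac{\mu}{\sigma}+\sqrt{1+\left(\tfrac{\mu}{\sigma}\right)^2}\right)^{1/3}+\left(\tfrac{\mu}{\sigma}-\sqrt{1+\left(\tfrac{\mu}{\sigma}\right)^2}\right)^{1/3}\right),\qquad \pi_h^*=\beta-\sqrt{\beta\left(\beta-\mu-\tfrac{\sigma^2}{\mu}\right)}.$$ $\delta^*\in(0,\sigma_{\max})$ is the threshold (depending on $\mu,\beta$; known to exist) such that $\sup_{p>0}\inf_{\mathbb{P}\in\mathcal{P}(\mu,\sigma,\beta)}\mathrm{REV}(p,\mathbb{P})$ is attained at $\pi_l^*$ for $\sigma\le\delta^*$ and at $\pi_h^*$ for $\sigma\ge\delta^*$. *)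

theory Defs
  imports "HOL-Probability.Probability"
begin

definition price_dists :: "real \<Rightarrow> real \<Rightarrow> real \<Rightarrow> real measure set" where
  "price_dists \<mu> \<sigma> \<beta> =
     {P. real_distribution P \<and> measure P {0..\<beta>} = 1 \<and>
         (\<integral>x. x \<partial>P) = \<mu> \<and> (\<integral>x. x\<^sup>2 \<partial>P) = \<mu>\<^sup>2 + \<sigma>\<^sup>2}"

definition REV :: "real \<Rightarrow> real measure \<Rightarrow> real" where
  "REV p P = p * measure P {p..}"

text \<open>For a distribution with bounded support and positive mean the supremum below is
  over a bounded set and is positive, so the real-valued supremum and the division carry
  their usual meaning.\<close>

definition CR :: "real \<Rightarrow> real measure \<Rightarrow> real" where
  "CR p P = REV p P / (SUP t\<in>{0<..}. REV t P)"

definition worst_REV :: "real \<Rightarrow> real \<Rightarrow> real \<Rightarrow> real \<Rightarrow> real" where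
  "worst_REV \<mu> \<sigma> \<beta> p = (INF P\<in>price_dists \<mu> \<sigma> \<beta>. REV p P)"

definition worst_CR :: "real \<Rightarrow> real \<Rightarrow> real \<Rightarrow> real \<Rightarrow> real" where
  "worst_CR \<mu> \<sigma> \<beta> p = (INF P\<in>price_dists \<mu> \<sigma> \<beta>. CR p P)"

definition sup_attained_at :: "(real \<Rightarrow> real) \<Rightarrow> real \<Rightarrow> bool" where
  "sup_attained_at F p \<longleftrightarrow> 0 < p \<and> F p = (SUP q\<in>{0<..}. F q)"

definition sigma_max :: "real \<Rightarrow> real \<Rightarrow> real" where
  "sigma_max \<mu> \<beta> = sqrt (\<mu> * (\<beta> - \<mu>))"

definition tau2 :: "real \<Rightarrow> real \<Rightarrow> real" where
  "tau2 \<mu> \<sigma> = \<mu> + \<sigma>\<^sup>2 / \<mu>"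

text \<open>\<open>root 3\<close> is the odd real cube root, also on negative arguments
  (unlike \<open>powr (1/3)\<close>).\<close>

definition p_l :: "real \<Rightarrow> real \<Rightarrow> real" where
  "p_l \<mu> \<sigma> = \<mu> - \<sigma> *
     (root 3 (\<mu> / (2 * \<sigma>) + sqrt (8 / 27 + (\<mu> / (2 * \<sigma>))\<^sup>2)) +
      root 3 (\<mu> / (2 * \<sigma>) - sqrt (8 / 27 + (\<mu> / (2 * \<sigma>))\<^sup>2)))"

definition p_h :: "real \<Rightarrow> real \<Rightarrow> real \<Rightarrow> real" where
  "p_h \<mu> \<sigma> \<beta> = max
     (1 / 2 * (\<beta> + tau2 \<mu> \<sigma> - sqrt ((3 * \<beta> - tau2 \<mu> \<sigma>)\<^sup>2 - 4 * \<beta>\<^sup>2)))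
     (tau2 \<mu> \<sigma> / 2)"

definition pi_l :: "real \<Rightarrow> real \<Rightarrow> real" where
  "pi_l \<mu> \<sigma> = \<mu> - \<sigma> *
     (root 3 (\<mu> / \<sigma> + sqrt (1 + (\<mu> / \<sigma>)\<^sup>2)) +
      root 3 (\<mu> / \<sigma> - sqrt (1 + (\<mu> / \<sigma>)\<^sup>2)))"

definition pi_h :: "real \<Rightarrow> real \<Rightarrow> real \<Rightarrow> real" where
  "pi_h \<mu> \<sigma> \<beta> = \<beta> - sqrt (\<beta> * (\<beta> - \<mu> - \<sigma>\<^sup>2 / \<mu>))"

text \<open>The thresholds \<open>\<sigma>*\<close> and \<open>\<delta>*\<close> are rendered as predicates on a real number that
  depend on \<open>\<mu>\<close> and \<open>\<beta>\<close> only: \<open>\<sigma>\<close> is quantified inside the definition.\<close>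

definition is_CR_threshold :: "real \<Rightarrow> real \<Rightarrow> real \<Rightarrow> bool" where
  "is_CR_threshold \<mu> \<beta> s \<longleftrightarrow> s \<in> {0<..<sigma_max \<mu> \<beta>} \<and>
     (\<forall>\<sigma>\<in>{0<..<sigma_max \<mu> \<beta>}.
        (\<sigma> \<le> s \<longrightarrow> sup_attained_at (worst_CR \<mu> \<sigma> \<beta>) (p_l \<mu> \<sigma>)) \<and>
        (\<sigma> \<ge> s \<longrightarrow> sup_attained_at (worst_CR \<mu> \<sigma> \<beta>) (p_h \<mu> \<sigma> \<beta>)))"

definition is_REV_threshold :: "real \<Rightarrow> real \<Rightarrow> real \<Rightarrow> bool" where
  "is_REV_threshold \<mu> \<beta> d \<longleftrightarrow> d \<in> {0<..<sigma_max \<mu> \<beta>} \<and>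
     (\<forall>\<sigma>\<in>{0<..<sigma_max \<mu> \<beta>}.
        (\<sigma> \<le> d \<longrightarrow> sup_attained_at (worst_REV \<mu> \<sigma> \<beta>) (pi_l \<mu> \<sigma>)) \<and>
        (\<sigma> \<ge> d \<longrightarrow> sup_attained_at (worst_REV \<mu> \<sigma> \<beta>) (pi_h \<mu> \<sigma> \<beta>)))"

end

theory Submission
  imports Defs
begin

text \<open>
  Both comparisons are elementary once the closed forms are replaced by the equations
  they solve.

  For the low prices, put \<open>a = \<mu> / \<sigma>\<close>. The sums of cube roots in \<open>pi_l\<close> and \<open>p_l\<close> are
  Cardano's expressions for the real roots \<open>x\<close> of \<open>x\<^sup>3 + 3 x = 2 a\<close> and \<open>y\<close> of
  \<open>y\<^sup>3 + 2 y = a\<close> (\<open>cardano_root\<close>). At the positive number \<open>y\<close> the first cubic has the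
  value \<open>y\<^sup>3 + 3 y < 2 (y\<^sup>3 + 2 y) = 2 a\<close>, so that \<open>y < x\<close> by monotonicity, and the larger
  multiple of \<open>\<sigma>\<close> is subtracted in \<open>pi_l\<close>.

  For the high prices, write \<open>\<tau>\<close> for \<open>tau2 \<mu> \<sigma>\<close>. The bound on \<open>\<sigma>\<close> says that
  \<open>\<tau> < \<beta>\<close>, and \<open>pi_h = \<beta> - r\<close> with \<open>r\<close> the geometric mean of \<open>\<beta>\<close> and
  \<open>d = \<beta> - \<tau>\<close>. That \<open>pi_h\<close> exceeds \<open>\<tau> / 2\<close> is the strict inequality between
  the geometric and the arithmetic mean. The other candidate in \<open>p_h\<close> equals
  \<open>(\<beta> + \<tau> - S) / 2\<close> with \<open>S\<^sup>2 = d (4 \<beta> + d)\<close>, and \<open>pi_h\<close> exceeds it because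
  \<open>(2 r - d)\<^sup>2 = S\<^sup>2 - 4 r d < S\<^sup>2\<close>.
\<close>

text \<open>Cardano's formula. The two cube roots have product \<open>- q\<close>, because their radicands
  have product \<open>b\<^sup>2 - (q\<^sup>3 + b\<^sup>2)\<close>; expanding the cube of the sum then leaves the equation.\<close>

lemma cardano_root:
  fixes b q :: real
  assumes "0 \<le> q"
  defines "y \<equiv> root 3 (b + sqrt (q ^ 3 + b\<^sup>2)) + root 3 (b - sqrt (q ^ 3 + b\<^sup>2))"
  shows "y ^ 3 + 3 * q * y = 2 * b"
proof -
  define s where "s = sqrt (q ^ 3 + b\<^sup>2)"
  define u where "u = root 3 (b + s)"
  define v where "v = root 3 (b - s)"
  have s2: "s\<^sup>2 = q ^ 3 + b\<^sup>2"
    using assms(1) by (simp add: s_def)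
  have cubes: "u ^ 3 = b + s" "v ^ 3 = b - s"
    by (simp_all add: u_def v_def odd_real_root_pow)
  have "(b + s) * (b - s) = (- q) ^ 3"
    using s2 by (simp add: algebra_simps power2_eq_square)
  then have uv: "u * v = - q"
    by (simp only: u_def v_def flip: real_root_mult) (rule odd_real_root_power_cancel, simp)
  have "(u + v) ^ 3 = u ^ 3 + v ^ 3 + 3 * (u * v) * (u + v)"
    by (simp add: power3_eq_cube algebra_simps)
  then have "(u + v) ^ 3 = 2 * b - 3 * q * (u + v)"
    by (simp add: cubes uv)
  then show ?thesis
    by (simp add: y_def u_def v_def s_def)
qed

lemma depressed_cubic_less_iff:
  fixes x y c :: real
  assumes "0 < c"
  shows "x ^ 3 + c * x < y ^ 3 + c * y \<longleftrightarrow> x < y"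
proof -
  have "strict_mono (\<lambda>z. z ^ 3 + c * z)"
    using assms by (intro strict_monoI add_le_less_mono) (simp_all add: power_mono_odd)
  then show ?thesis
    by (rule strict_mono_less)
qed

lemma pi_l_less_p_l:
  assumes "0 < \<mu>" "0 < \<sigma>"
  shows "pi_l \<mu> \<sigma> < p_l \<mu> \<sigma>"
proof -
  define a where "a = \<mu> / \<sigma>"
  define x where "x = root 3 (a + sqrt (1 + a\<^sup>2)) + root 3 (a - sqrt (1 + a\<^sup>2))"
  define y where "y = root 3 (a / 2 + sqrt (8 / 27 + (a / 2)\<^sup>2))
    + root 3 (a / 2 - sqrt (8 / 27 + (a / 2)\<^sup>2))"
  have "a > 0"
    using assms by (simp add: a_def)
  have x: "x ^ 3 + 3 * x = 2 * a"
    using cardano_root [of 1 a] by (simp add: x_def)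
  have y: "y ^ 3 + 2 * y = a"
    using cardano_root [of "2 / 3" "a / 2"] by (simp add: y_def power3_eq_cube)
  have "0 < y"
    using depressed_cubic_less_iff [of 2 0 y] \<open>a > 0\<close> y by simp
  then have "y ^ 3 > 0"
    by simp
  then have "y ^ 3 + 3 * y < x ^ 3 + 3 * x"
    using x y \<open>0 < y\<close> by linarith
  then have "y < x"
    by (simp add: depressed_cubic_less_iff)
  moreover have "pi_l \<mu> \<sigma> = \<mu> - \<sigma> * x" "p_l \<mu> \<sigma> = \<mu> - \<sigma> * y"
    by (simp_all add: pi_l_def p_l_def x_def y_def a_def mult.commute)
  ultimately show ?thesis
    using \<open>0 < \<sigma>\<close> by simp
qed

lemma tau2_less:
  assumes "0 < \<mu>" "0 < \<sigma>" "\<sigma> < sigma_max \<mu> \<beta>"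
  shows "tau2 \<mu> \<sigma> < \<beta>"
proof -
  have "\<sigma>\<^sup>2 < \<mu> * (\<beta> - \<mu>)"
    using assms real_sqrt_less_iff[of "\<sigma>\<^sup>2" "\<mu> * (\<beta> - \<mu>)"] by (simp add: sigma_max_def)
  then show ?thesis
    using \<open>0 < \<mu>\<close> by (simp add: tau2_def field_simps)
qed

lemma pi_h_greater_p_h:
  assumes "0 < \<mu>" "tau2 \<mu> \<sigma> < \<beta>"
  shows "p_h \<mu> \<sigma> \<beta> < pi_h \<mu> \<sigma> \<beta>"
proof -
  define \<tau> where "\<tau> = tau2 \<mu> \<sigma>"
  define d where "d = \<beta> - \<tau>"
  define r where "r = sqrt (\<beta> * d)"
  have "\<tau> > 0"
    using \<open>0 < \<mu>\<close> by (simp add: \<tau>_def tau2_def add_pos_nonneg)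
  have "d > 0"
    using assms by (simp add: d_def \<tau>_def)
  have "\<beta> > 0"
    using \<open>d > 0\<close> \<open>\<tau> > 0\<close> by (simp add: d_def)
  have "r > 0" and r2: "r\<^sup>2 = \<beta> * d"
    using \<open>\<beta> > 0\<close> \<open>d > 0\<close> by (simp_all add: r_def)
  have pi_h: "pi_h \<mu> \<sigma> \<beta> = \<beta> - r"
    by (simp add: pi_h_def r_def d_def \<tau>_def tau2_def diff_diff_eq)
  have "\<tau> / 2 < \<beta> - r"
  proof -
    have "\<beta> * d < (\<beta> - \<tau> / 2)\<^sup>2"
      using \<open>\<tau> > 0\<close> by (simp add: d_def power2_eq_square algebra_simps)
    moreover have "0 < \<beta> - \<tau> / 2"
      using \<open>d > 0\<close> \<open>\<tau> > 0\<close> by (simp add: d_def)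
    ultimately have "r < \<beta> - \<tau> / 2"
      unfolding r_def by (intro real_less_lsqrt) simp_all
    then show ?thesis by simp
  qed
  moreover have "1 / 2 * (\<beta> + \<tau> - sqrt ((3 * \<beta> - \<tau>)\<^sup>2 - 4 * \<beta>\<^sup>2)) < \<beta> - r"
  proof -
    have "(2 * r - d)\<^sup>2 = 4 * r\<^sup>2 - 4 * (r * d) + d\<^sup>2"
      by (simp add: power2_eq_square algebra_simps)
    also have "\<dots> < 4 * (\<beta> * d) + d\<^sup>2"
      using \<open>r > 0\<close> \<open>d > 0\<close> by (simp add: r2)
    also have "\<dots> = (3 * \<beta> - \<tau>)\<^sup>2 - 4 * \<beta>\<^sup>2"
      by (simp add: d_def power2_eq_square algebra_simps)
    finally have "2 * r - d < sqrt ((3 * \<beta> - \<tau>)\<^sup>2 - 4 * \<beta>\<^sup>2)"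
      by (rule real_less_rsqrt)
    then show ?thesis
      by (simp add: d_def)
  qed
  ultimately show ?thesis
    by (simp add: p_h_def pi_h \<tau>_def)
qed

theorem theorem5p2:
  fixes \<mu> \<beta> \<sigma> \<sigma>star \<delta>star :: real
  assumes "0 < \<mu>" and "\<mu> < \<beta>"
    and "\<sigma> \<in> {0<..<sigma_max \<mu> \<beta>}"
    and "is_CR_threshold \<mu> \<beta> \<sigma>star"
    and "is_REV_threshold \<mu> \<beta> \<delta>star"
  shows "(\<sigma> \<le> min \<delta>star \<sigma>star \<longrightarrow> pi_l \<mu> \<sigma> < p_l \<mu> \<sigma>) \<and>
         (\<sigma> \<ge> max \<delta>star \<sigma>star \<longrightarrow> pi_h \<mu> \<sigma> \<beta> > p_h \<mu> \<sigma> \<beta>)"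
  using assms pi_l_less_p_l pi_h_greater_p_h tau2_less by simp

end
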